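(* Let $A \subseteq \omega$ be a crisp set, viewed as the fuzzy set $A\colon \omega \to \{0,1\} \subseteq [0;1]_{\mathbb{R}}$, and let $n \geq 1$. Then $A$ is $n$-c.e. in the classical sense if and only if $A$ is fuzzy $n$-c.e. Likewise, $A$ is co-$n$-c.e. in the classical sense if and only if $A$ is fuzzy co-$n$-c.e.
   Context: A fuzzy subset of $\omega$ is a function $A\colon \omega \to [0;1]_{\mathbb{R}}$; it is crisp if $A(x) \in \{0,1\}$ for all $x$. The complement of a fuzzy set is $\overline{A}(x) = 1 - A(x)$. $[0;1]_{\mathbb{Q}}$ denotes the rationals in $[0,1]$, coded effectively by natural numbers. Classical: a set $A \subseteq \omega$ is $n$-c.e. if there is a computable $f\colon \omega\times\omega \to \{0,1\}$ such that for all $x$: $\lim_s f(x,s) = A(x)$, $f(x,0)=0$, and $|\{s : f(x,s) \neq f(x,s+1)\}| \leq n$. $A$ is co-$n$-c.e. if $\omega\setminus A$ is $n$-c.e. For a total $f\colon \omega\times\omega \to [0;1]_{\mathbb{Q}}$, its $\Sigma$-mind change function $m^f_\Sigma\colon \omega\times\omega \to \{-1,1\}$ is defined by: $m^f_\Sigma(x,0) = 1$; if $m^f_\Sigma(x,s)=1$, then $m^f_\Sigma(x,s+1)=1$ when $f(x,s)\leq f(x,s+1)$ and $m^f_\Sigma(x,s+1)=-1$ when $f(x,s) > f(x,s+1)$; if $m^f_\Sigma(x,s)=-1$, then $m^f_\Sigma(x,s+1)=-1$ when $f(x,s)\geq f(x,s+1)$ and $m^f_\Sigma(x,s+1)=1$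 when $f(x,s)<f(x,s+1)$. A fuzzy set $A$ is fuzzy $n$-c.e. ($n \geq 1$) if there is a computable $f\colon \omega\times\omega \to [0;1]_{\mathbb{Q}}$ such that for all $x$: $\lim_s f(x,s) = A(x)$, $f(x,0) = 0$, and $|\{s \in \omega : m^f_\Sigma(x,s+1) \neq m^f_\Sigma(x,s)\}| \leq n-1$. A fuzzy set $A$ is fuzzy co-$n$-c.e. if its complement $\overline{A}$ is fuzzy $n$-c.e. *)

theory Defs
  imports Complex_Main "HOL-Library.Nat_Bijection" "HOL-Library.Indicator_Function"
begin

section \<open>Computable functions\<close>

text \<open>
  Computability is understood as \<open>\<mu>\<close>-recursiveness. Programs act on argument lists;
  \<open>Prim f g\<close> recurses on the first argument, and \<open>Mu f\<close> searches for the least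
  first argument at which \<open>f\<close> vanishes, all earlier values being defined.
\<close>

datatype recf =
    Zero
  | Succ
  | Proj nat
  | Comp recf "recf list"
  | Prim recf recf
  | Mu recf

inductive rec_eval :: "recf \<Rightarrow> nat list \<Rightarrow> nat \<Rightarrow> bool" where
  Zero: "rec_eval Zero xs 0"
| Succ: "rec_eval Succ [x] (Suc x)"
| Proj: "i < length xs \<Longrightarrow> rec_eval (Proj i) xs (xs ! i)"
| Comp: "list_all2 (\<lambda>g y. rec_eval g xs y) gs ys \<Longrightarrow> rec_eval f ys z
    \<Longrightarrow> rec_eval (Comp f gs) xs z"
| Prim_0: "rec_eval f xs y \<Longrightarrow> rec_eval (Prim f g) (0 # xs) y"
| Prim_Suc: "rec_eval (Prim f g) (k # xs) y \<Longrightarrow> rec_eval g (k # y # xs) z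
    \<Longrightarrow> rec_eval (Prim f g) (Suc k # xs) z"
| Mu: "rec_eval f (k # xs) 0 \<Longrightarrow> (\<forall>i<k. \<exists>y. rec_eval f (i # xs) (Suc y))
    \<Longrightarrow> rec_eval (Mu f) xs k"

inductive_simps rec_eval_simps:
  "rec_eval Zero xs z"
  "rec_eval Succ xs z"
  "rec_eval (Proj i) xs z"
  "rec_eval (Comp f gs) xs z"
  "rec_eval (Prim f g) (0 # xs) z"
  "rec_eval (Prim f g) (Suc k # xs) z"
  "rec_eval (Mu f) xs z"

lemma rec_eval_deterministic:
  "rec_eval p xs y \<Longrightarrow> rec_eval p xs z \<Longrightarrow> y = z"
proof (induction p xs y arbitrary: z rule: rec_eval.induct)
  case (Comp xs gs ys f w)
  from Comp.prems obtain ys' where ys': "list_all2 (\<lambda>g y. rec_eval g xs y) gs ys'"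
    "rec_eval f ys' z"
    by (auto simp: rec_eval_simps)
  have "ys = ys'"
    using Comp.IH(1) ys'(1) by (auto simp: list_all2_conv_all_nth intro!: nth_equalityI)
  with Comp.IH ys' show ?case by blast
next
  case (Prim_Suc f g k xs y w)
  from Prim_Suc.prems obtain y' where "rec_eval (Prim f g) (k # xs) y'" "rec_eval g (k # y' # xs) z"
    by (auto simp: rec_eval_simps)
  with Prim_Suc.IH show ?case by blast
next
  case (Mu f k xs)
  from Mu.prems have z: "rec_eval f (z # xs) 0" "\<forall>i<z. \<exists>y. rec_eval f (i # xs) (Suc y)"
    by (auto simp: rec_eval_simps)
  show ?case
  proof (rule linorder_cases[of k z])
    assume "k < z"
    with z(2) Mu.IH(1) show ?thesis by blast
  next
    assume "z < k"
    with z(1) Mu.IH(2) show ?thesis by blast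
  qed
qed (auto simp: rec_eval_simps)

definition computable2 :: "(nat \<Rightarrow> nat \<Rightarrow> nat) \<Rightarrow> bool" where
  "computable2 f \<longleftrightarrow> (\<exists>p. \<forall>x s. rec_eval p [x, s] (f x s))"

text \<open>
  A rational of the unit interval is coded by the Cantor pair of numerator and denominator in
  lowest terms. (On negative rationals, where it is never used, the code is not meaningful.)
\<close>

definition rat_code :: "rat \<Rightarrow> nat" where
  "rat_code q = prod_encode (nat (fst (quotient_of q)), nat (snd (quotient_of q)))"

lemma inj_on_rat_code: "inj_on rat_code {0..1}"
proof (rule inj_onI)
  fix p q :: rat
  assume "p \<in> {0..1}" "q \<in> {0..1}" and eq: "rat_code p = rat_code q"
  obtain a b c d where ab: "quotient_of p = (a, b)" and cd: "quotient_of q = (c, d)"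
    by (meson surj_pair)
  have "b > 0" "d > 0" using ab cd by (auto dest: quotient_of_denom_pos)
  moreover have "a \<ge> 0" "c \<ge> 0"
    using \<open>p \<in> _\<close> \<open>q \<in> _\<close> quotient_of_div[OF ab] quotient_of_div[OF cd] \<open>b > 0\<close> \<open>d > 0\<close>
    by (auto simp: zero_le_divide_iff)
  ultimately have "a = c" "b = d"
    using eq ab cd by (auto simp: rat_code_def)
  thus "p = q" using quotient_of_div[OF ab] quotient_of_div[OF cd] by simp
qed

definition computable2_rat :: "(nat \<Rightarrow> nat \<Rightarrow> rat) \<Rightarrow> bool" where
  "computable2_rat f \<longleftrightarrow> computable2 (\<lambda>x s. rat_code (f x s))"


section \<open>The classical difference hierarchy\<close>

text \<open>Finiteness of the sets of mind changes is required explicitly, here and below, because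
  \<open>card\<close> is \<open>0\<close> on infinite sets.\<close>

definition n_ce :: "nat \<Rightarrow> nat set \<Rightarrow> bool" where
  "n_ce n A \<longleftrightarrow> (\<exists>f :: nat \<Rightarrow> nat \<Rightarrow> nat.
     computable2 f \<and> (\<forall>x s. f x s \<in> {0, 1}) \<and>
     (\<forall>x. (\<lambda>s. f x s) \<longlonglongrightarrow> indicator A x \<and>
          f x 0 = 0 \<and>
          finite {s. f x s \<noteq> f x (s + 1)} \<and>
          card {s. f x s \<noteq> f x (s + 1)} \<le> n))"

definition co_n_ce :: "nat \<Rightarrow> nat set \<Rightarrow> bool" where
  "co_n_ce n A \<longleftrightarrow> n_ce n (- A)"


section \<open>The fuzzy difference hierarchy\<close>

definition fuzzy_set :: "(nat \<Rightarrow> real) \<Rightarrow> bool" where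
  "fuzzy_set A \<longleftrightarrow> (\<forall>x. A x \<in> {0..1})"

definition fuzzy_complement :: "(nat \<Rightarrow> real) \<Rightarrow> nat \<Rightarrow> real" where
  "fuzzy_complement A = (\<lambda>x. 1 - A x)"

fun mind_change :: "(nat \<Rightarrow> nat \<Rightarrow> rat) \<Rightarrow> nat \<Rightarrow> nat \<Rightarrow> int" where
  "mind_change f x 0 = 1"
| "mind_change f x (Suc s) =
     (if mind_change f x s = 1
      then (if f x s \<le> f x (Suc s) then 1 else - 1)
      else (if f x s \<ge> f x (Suc s) then - 1 else 1))"

definition fuzzy_n_ce :: "nat \<Rightarrow> (nat \<Rightarrow> real) \<Rightarrow> bool" where
  "fuzzy_n_ce n A \<longleftrightarrow> fuzzy_set A \<and> (\<exists>f :: nat \<Rightarrow> nat \<Rightarrow> rat.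
     computable2_rat f \<and> (\<forall>x s. f x s \<in> {0..1}) \<and>
     (\<forall>x. (\<lambda>s. real_of_rat (f x s)) \<longlonglongrightarrow> A x \<and>
          f x 0 = 0 \<and>
          finite {s. mind_change f x (s + 1) \<noteq> mind_change f x s} \<and>
          card {s. mind_change f x (s + 1) \<noteq> mind_change f x s} \<le> n - 1))"

definition fuzzy_co_n_ce :: "nat \<Rightarrow> (nat \<Rightarrow> real) \<Rightarrow> bool" where
  "fuzzy_co_n_ce n A \<longleftrightarrow> fuzzy_set A \<and> fuzzy_n_ce n (fuzzy_complement A)"

end

theory Submission
  imports Defs
begin

text \<open>
  A 0-1-valued approximation is also a fuzzy one; its first change goes upwards and is therefore
  not a mind change, which accounts for the bound \<open>n - 1\<close>. Conversely, round a fuzzy approximation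
  at the threshold \<open>1/2\<close>. Whenever the rounded value changes, the mind change function takes the
  direction of that change, so between two consecutive changes of the rounded value there is a mind
  change. The rounding is computable because the diagonal of Cantor's enumeration on which a
  code lies can be found by unbounded search.
\<close>

section \<open>Recursive programs\<close>

text \<open>With the list of intermediate values fixed, composition becomes a rule for backward
  chaining, so that each program below is verified by following its syntax.\<close>

lemma rec_eval_Comp1:
  "rec_eval g xs y \<Longrightarrow> rec_eval f [y] z \<Longrightarrow> rec_eval (Comp f [g]) xs z"
  by (rule rec_eval.Comp[where ys = "[y]"]) auto

lemma rec_eval_Comp2:
  "rec_eval g xs y \<Longrightarrow> rec_eval h xs y' \<Longrightarrow> rec_eval f [y, y'] z
    \<Longrightarrow> rec_eval (Comp f [g, h]) xs z"
  by (rule rec_eval.Comp[where ys = "[y, y']"]) auto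

lemma rec_eval_Proj0: "rec_eval (Proj 0) (x # xs) x"
  by (simp add: rec_eval_simps)

lemma rec_eval_Proj1: "rec_eval (Proj 1) (x # y # xs) y"
  by (simp add: rec_eval_simps)

section \<open>Truncated arithmetic\<close>

definition rec_add :: recf where
  "rec_add = Prim (Proj 0) (Comp Succ [Proj 1])"

lemma rec_eval_add: "rec_eval rec_add [x, y] (x + y)"
proof (induction x)
  case 0
  show ?case by (auto simp: rec_add_def intro: rec_eval_Proj0 rec_eval.Prim_0)
next
  case (Suc x)
  have "rec_eval (Comp Succ [Proj 1]) [x, x + y, y] (Suc (x + y))"
    by (rule rec_eval_Comp1[OF rec_eval_Proj1 rec_eval.Succ])
  with Suc show ?case by (auto simp: rec_add_def intro: rec_eval.Prim_Suc)
qed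

definition rec_pred :: recf where
  "rec_pred = Prim Zero (Proj 0)"

lemma rec_eval_pred: "rec_eval rec_pred [x] (x - 1)"
  unfolding rec_pred_def
  by (induction x) (auto intro: rec_eval.Zero rec_eval_Proj0 rec_eval.Prim_0 rec_eval.Prim_Suc)

text \<open>\<open>Prim\<close> recurses on the first argument, hence the reversed order in subtraction.\<close>

definition rec_rsub :: recf where
  "rec_rsub = Prim (Proj 0) (Comp rec_pred [Proj 1])"

lemma rec_eval_rsub: "rec_eval rec_rsub [y, x] (x - y)"
proof (induction y)
  case 0
  show ?case by (auto simp: rec_rsub_def intro: rec_eval_Proj0 rec_eval.Prim_0)
next
  case (Suc y)
  have "rec_eval (Comp rec_pred [Proj 1]) [y, x - y, x] (x - y - 1)"
    by (rule rec_eval_Comp1[OF rec_eval_Proj1 rec_eval_pred])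
  with Suc show ?case
    by (auto simp: rec_rsub_def intro: rec_eval.Prim_Suc)
qed

definition rec_sgn :: recf where
  "rec_sgn = Prim Zero (Comp Succ [Zero])"

lemma rec_eval_sgn: "rec_eval rec_sgn [x] (if x = 0 then 0 else 1)"
proof (induction x)
  case 0
  show ?case by (auto simp: rec_sgn_def intro: rec_eval.Zero rec_eval.Prim_0)
next
  case (Suc x)
  have "rec_eval (Comp Succ [Zero]) [x, y] (Suc 0)" for y
    by (rule rec_eval_Comp1[OF rec_eval.Zero rec_eval.Succ])
  with Suc show ?case by (auto simp: rec_sgn_def intro: rec_eval.Prim_Suc)
qed

section \<open>Decoding Cantor pairs\<close>

definition rec_triangle :: recf where
  "rec_triangle = Prim Zero (Comp rec_add [Proj 1, Comp Succ [Proj 0]])"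

lemma rec_eval_triangle: "rec_eval rec_triangle [k] (triangle k)"
proof (induction k)
  case 0
  show ?case by (auto simp: rec_triangle_def intro: rec_eval.Zero rec_eval.Prim_0)
next
  case (Suc k)
  have "rec_eval (Comp rec_add [Proj 1, Comp Succ [Proj 0]]) [k, triangle k]
      (triangle k + Suc k)"
    by (intro rec_eval_Comp2[OF rec_eval_Proj1 _ rec_eval_add]
        rec_eval_Comp1[OF rec_eval_Proj0 rec_eval.Succ])
  with Suc show ?case by (auto simp: rec_triangle_def intro: rec_eval.Prim_Suc)
qed

text \<open>Since \<open>prod_encode (a, b) = triangle (a + b) + a\<close>, the least
  \<open>k\<close> with code below \<open>triangle (Suc k)\<close> is \<open>a + b\<close>. The
  successor of the code makes this strict inequality the vanishing of a truncated
  difference.\<close>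

definition rec_diagonal :: recf where
  "rec_diagonal =
     Mu (Comp rec_rsub [Comp rec_triangle [Comp Succ [Proj 0]], Comp Succ [Proj 1]])"

lemma rec_eval_diagonal: "rec_eval rec_diagonal [prod_encode (a, b)] (a + b)"
proof -
  let ?c = "prod_encode (a, b)"
  let ?p = "Comp rec_rsub [Comp rec_triangle [Comp Succ [Proj 0]], Comp Succ [Proj 1]]"
  have eval: "rec_eval ?p [k, ?c] (Suc ?c - triangle (Suc k))" for k
    by (intro rec_eval_Comp2[OF _ _ rec_eval_rsub] rec_eval_Comp1[OF _ rec_eval_triangle]
        rec_eval_Comp1[OF rec_eval_Proj0 rec_eval.Succ]
        rec_eval_Comp1[OF rec_eval_Proj1 rec_eval.Succ])
  \<comment> \<open>For \<open>k < a + b\<close> the code is at least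
    \<open>triangle (a + b)\<close>, hence at least \<open>triangle (Suc k)\<close>: the search
    cannot stop early.\<close>
  have mono: "triangle (Suc k) \<le> triangle (a + b)" if "k < a + b" for k
    unfolding triangle_def using that by (intro div_le_mono mult_le_mono) auto
  show ?thesis unfolding rec_diagonal_def
  proof (rule rec_eval.Mu)
    have "Suc ?c - triangle (Suc (a + b)) = 0"
      by (simp add: prod_encode_def)
    then show "rec_eval ?p [a + b, ?c] 0" using eval[of "a + b"] by simp
    show "\<forall>k<a + b. \<exists>y. rec_eval ?p [k, ?c] (Suc y)"
    proof (intro allI impI)
      fix k assume "k < a + b"
      then have "Suc ?c - triangle (Suc k) = Suc (?c - triangle (Suc k))"
        using mono[of k] by (simp add: prod_encode_def del: triangle_Suc)
      then show "\<exists>y. rec_eval ?p [k, ?c] (Suc y)" using eval[of k] by metis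
    qed
  qed
qed

text \<open>The first component is the offset of the code from the start of its diagonal.\<close>

definition rec_numerator :: recf where
  "rec_numerator = Comp rec_rsub [Comp rec_triangle [rec_diagonal], Proj 0]"

lemma rec_eval_numerator: "rec_eval rec_numerator [prod_encode (a, b)] a"
proof -
  have "rec_eval rec_numerator [prod_encode (a, b)] (prod_encode (a, b) - triangle (a + b))"
    unfolding rec_numerator_def
    by (intro rec_eval_Comp2[OF _ rec_eval_Proj0 rec_eval_rsub]
        rec_eval_Comp1[OF rec_eval_diagonal rec_eval_triangle])
  then show ?thesis by (simp add: prod_encode_def)
qed

text \<open>The fraction \<open>a / b\<close> exceeds \<open>1/2\<close> iff \<open>3 a\<close> exceeds the diagonal index \<open>a + b\<close>.\<close>

definition rec_gt_half :: recf where
  "rec_gt_half = Comp rec_sgn [Comp rec_rsub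
     [rec_diagonal, Comp rec_add [rec_numerator, Comp rec_add [rec_numerator, rec_numerator]]]]"

lemma rec_eval_gt_half:
  "rec_eval rec_gt_half [prod_encode (a, b)] (if b < 2 * a then 1 else 0)"
proof -
  have "rec_eval rec_gt_half [prod_encode (a, b)]
      (if a + (a + a) - (a + b) = 0 then 0 else 1)"
    unfolding rec_gt_half_def
    by (intro rec_eval_Comp1[OF _ rec_eval_sgn] rec_eval_Comp2[OF rec_eval_diagonal _ rec_eval_rsub]
        rec_eval_Comp2[OF rec_eval_numerator _ rec_eval_add]
        rec_eval_Comp2[OF rec_eval_numerator rec_eval_numerator rec_eval_add])
  moreover have "(if a + (a + a) - (a + b) = 0 then 0 else 1) = (if b < 2 * a then 1 else (0::nat))"
    by auto
  ultimately show ?thesis by simp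
qed

text \<open>For \<open>q\<close> \<ge> 0 the conversion \<open>nat\<close> inside
  \<open>rat_code\<close> loses nothing, so comparing the coded naturals compares the fraction
  itself.\<close>

lemma rec_eval_gt_half_rat_code:
  assumes "0 \<le> q"
  shows "rec_eval rec_gt_half [rat_code q] (if 1/2 < q then 1 else 0)"
proof -
  obtain a b where ab: "quotient_of q = (a, b)" by (meson surj_pair)
  have b: "b > 0" using ab by (rule quotient_of_denom_pos)
  have q: "q = of_int a / of_int b" using ab by (rule quotient_of_div)
  have a: "a \<ge> 0" using assms b q by (auto simp: zero_le_divide_iff)
  have "1/2 < q \<longleftrightarrow> (of_int b :: rat) < of_int (2 * a)"
    using b unfolding q by (simp add: field_simps)
  also have "\<dots> \<longleftrightarrow> b < 2 * a" by (rule of_int_less_iff)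
  also have "\<dots> \<longleftrightarrow> nat b < 2 * nat a" using a b by linarith
  finally show ?thesis
    using rec_eval_gt_half[of "nat a" "nat b"] ab by (simp add: rat_code_def)
qed

lemma computable2_gt_half:
  assumes "computable2_rat f" and "\<And>x s. 0 \<le> f x s"
  shows "computable2 (\<lambda>x s. if 1/2 < f x s then 1 else 0)"
proof -
  obtain p where "\<And>x s. rec_eval p [x, s] (rat_code (f x s))"
    using assms(1) by (auto simp: computable2_rat_def computable2_def)
  then have "\<And>x s. rec_eval (Comp rec_gt_half [p]) [x, s] (if 1/2 < f x s then 1 else 0)"
    using rec_eval_gt_half_rat_code[OF assms(2)] by (rule rec_eval_Comp1)
  then show ?thesis unfolding computable2_def by blast
qed

lemma rat_code_0: "rat_code 0 = 1"
  by (simp add: rat_code_def prod_encode_def)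

lemma rat_code_1: "rat_code 1 = 4"
  by (simp add: rat_code_def prod_encode_def)

lemma computable2_rat_of_nat:
  assumes "computable2 g" and "\<And>x s. g x s \<in> {0, 1}"
  shows "computable2_rat (\<lambda>x s. of_nat (g x s))"
proof -
  obtain p where p: "\<And>x s. rec_eval p [x, s] (g x s)"
    using assms(1) by (auto simp: computable2_def)
  \<comment> \<open>The codes of 0 and 1 are 1 and 4, and \<open>3 * v + 1\<close> interpolates
    them.\<close>
  have "rec_eval (Comp Succ [Comp rec_add [p, Comp rec_add [p, p]]]) [x, s]
      (Suc (g x s + (g x s + g x s)))" for x s
    by (intro rec_eval_Comp1[OF _ rec_eval.Succ] rec_eval_Comp2[OF p _ rec_eval_add]
        rec_eval_Comp2[OF p p rec_eval_add])
  moreover have "Suc (g x s + (g x s + g x s)) = rat_code (of_nat (g x s))" for x s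
    using assms(2)[of x s] by (auto simp: rat_code_0 rat_code_1)
  ultimately show ?thesis
    unfolding computable2_rat_def computable2_def by metis
qed

section \<open>Counting mind changes\<close>

lemma card_Collect_less_Suc:
  "card {t. t < Suc s \<and> P t} = card {t. t < s \<and> P t} + (if P s then 1 else 0)"
proof -
  have "{t. t < Suc s \<and> P t} = {t. t < s \<and> P t} \<union> (if P s then {s} else {})"
    by (auto simp: less_Suc_eq)
  then show ?thesis by simp
qed

text \<open>Every finite subset lies in an initial segment, and an infinite set would have a finite
  subset of size \<open>Suc k\<close>. This lets changes be counted by induction on the
  stage.\<close>

lemma finite_card_le_if_initial_segments:
  fixes P :: "nat \<Rightarrow> bool"
  assumes "\<And>s. card {t. t < s \<and> P t} \<le> k"
  shows "finite {t. P t} \<and> card {t. P t} \<le> k"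
proof -
  have le: "card F \<le> k" if "finite F" "F \<subseteq> {t. P t}" for F
  proof -
    have "F \<subseteq> {t. t < Suc (Max F) \<and> P t}"
      using that by (auto simp: less_Suc_eq_le)
    then have "card F \<le> card {t. t < Suc (Max F) \<and> P t}"
      by (intro card_mono) auto
    with assms show ?thesis using le_trans by blast
  qed
  have "finite {t. P t}"
  proof (rule ccontr)
    assume "infinite {t. P t}"
    then obtain F where "finite F" "card F = Suc k" "F \<subseteq> {t. P t}"
      using infinite_arbitrarily_large by blast
    with le[of F] show False by simp
  qed
  with le show ?thesis by simp
qed

section \<open>Threshold crossings against mind changes\<close>

lemma mind_change_values: "mind_change f x s = 1 \<or> mind_change f x s = - 1"
  by (cases s) auto

text \<open>The last summand is a credit, present when the side of the threshold agrees with the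
  current direction. It starts at 0, because the value is not above \<open>r\<close> while the
  direction is 1.\<close>

lemma threshold_changes_le_mind_changes:
  assumes "f x 0 \<le> r"
  shows "card {t. t < s \<and> (r < f x t) \<noteq> (r < f x (Suc t))}
    \<le> card {t. t < s \<and> mind_change f x (Suc t) \<noteq> mind_change f x t}
      + (if (r < f x s) = (mind_change f x s = 1) then 1 else 0)"
proof (induction s)
  case 0
  show ?case by simp
next
  case (Suc s)
  \<comment> \<open>After a crossing, side and direction agree. If they disagreed before, the new
    credit pays for the crossing; if they agreed, the direction has changed. Without a crossing, the
    credit is lost only through a mind change.\<close>
  then show ?case
    unfolding card_Collect_less_Suc
    using mind_change_values[of f x s] mind_change.simps(2)[of f x s]
    by (auto simp del: mind_change.simps split: if_splits)
qed

text \<open>The credit is at most 1, which gives the \<open>Suc\<close> uniformly in the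
  stage.\<close>

lemma finite_card_threshold_changes:
  assumes "f x 0 \<le> r" and fin: "finite {t. mind_change f x (Suc t) \<noteq> mind_change f x t}"
  shows "finite {t. (r < f x t) \<noteq> (r < f x (Suc t))} \<and>
    card {t. (r < f x t) \<noteq> (r < f x (Suc t))}
      \<le> Suc (card {t. mind_change f x (Suc t) \<noteq> mind_change f x t})"
proof (rule finite_card_le_if_initial_segments)
  fix s
  have "card {t. t < s \<and> mind_change f x (Suc t) \<noteq> mind_change f x t}
      \<le> card {t. mind_change f x (Suc t) \<noteq> mind_change f x t}"
    using fin by (intro card_mono) auto
  with threshold_changes_le_mind_changes[of f x r s, OF assms(1)]
  show "card {t. t < s \<and> (r < f x t) \<noteq> (r < f x (Suc t))}
      \<le> Suc (card {t. mind_change f x (Suc t) \<noteq> mind_change f x t})"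
    by (auto simp del: mind_change.simps split: if_splits)
qed

section \<open>Mind changes against changes of value\<close>

lemma mind_change_imp_neq:
  "mind_change f x (Suc s) \<noteq> mind_change f x s \<Longrightarrow> f x s \<noteq> f x (Suc s)"
  using mind_change_values[of f x s] by (auto split: if_splits)

lemma finite_card_mind_changes:
  assumes f0: "f x 0 = 0" and nonneg: "\<And>s. 0 \<le> f x s"
    and fin: "finite {s. f x s \<noteq> f x (Suc s)}"
  shows "finite {s. mind_change f x (Suc s) \<noteq> mind_change f x s} \<and>
    card {s. mind_change f x (Suc s) \<noteq> mind_change f x s}
      \<le> card {s. f x s \<noteq> f x (Suc s)} - 1"
\<comment> \<open>With no change of value the bound is the truncated \<open>0 - 1 = 0\<close>, so
  mind changes must be absent altogether.\<close>
proof (cases "{s. f x s \<noteq> f x (Suc s)} = {}")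
  case True
  then have "{s. mind_change f x (Suc s) \<noteq> mind_change f x s} = {}"
    using mind_change_imp_neq[of f x] by blast
  then show ?thesis by simp
next
  case False
  define s0 where "s0 = (LEAST s. f x s \<noteq> f x (Suc s))"
  have s0: "f x s0 \<noteq> f x (Suc s0)"
    unfolding s0_def using False by (intro LeastI_ex[of "\<lambda>s. f x s \<noteq> f x (Suc s)"]) blast
  have const: "f x s = 0 \<and> mind_change f x s = 1" if "s \<le> s0" for s
    using that
  proof (induction s)
    case 0
    show ?case using f0 by simp
  next
    case (Suc s)
    then have "f x s = f x (Suc s)"
      using not_less_Least[of s "\<lambda>s. f x s \<noteq> f x (Suc s)"] by (simp add: s0_def)
    with Suc show ?case by simp
  qed
  \<comment> \<open>The first change leaves the value 0 and can only go up, in the initial direction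
    1; so \<open>s0\<close> is a change of value but not a mind change.\<close>
  have "mind_change f x (Suc s0) = mind_change f x s0"
    using const[of s0] nonneg[of "Suc s0"] by simp
  then have sub: "{s. mind_change f x (Suc s) \<noteq> mind_change f x s}
      \<subseteq> {s. f x s \<noteq> f x (Suc s)} - {s0}"
    using mind_change_imp_neq[of f x] by blast
  have "card ({s. f x s \<noteq> f x (Suc s)} - {s0}) = card {s. f x s \<noteq> f x (Suc s)} - 1"
    using s0 by (simp add: card_Diff_singleton)
  moreover have fin': "finite ({s. f x s \<noteq> f x (Suc s)} - {s0})"
    using fin by simp
  ultimately show ?thesis
    using finite_subset[OF sub fin'] card_mono[OF fin' sub] by argo
qed

section \<open>Crisp sets in the two hierarchies\<close>

lemma fuzzy_set_indicator: "fuzzy_set (indicator A)"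
  by (simp add: fuzzy_set_def indicator_def)

lemma fuzzy_complement_indicator: "fuzzy_complement (indicator A) = indicator (- A)"
  by (auto simp: fuzzy_complement_def indicator_def)

lemma n_ce_imp_fuzzy_n_ce:
  assumes "n_ce n A"
  shows "fuzzy_n_ce n (indicator A)"
proof -
  obtain g :: "nat \<Rightarrow> nat \<Rightarrow> nat" where comp: "computable2 g" and g01: "\<And>x s. g x s \<in> {0, 1}"
    and lim: "\<And>x. g x \<longlonglongrightarrow> indicator A x" and g0: "\<And>x. g x 0 = 0"
    and fin: "\<And>x. finite {s. g x s \<noteq> g x (Suc s)}"
    and card: "\<And>x. card {s. g x s \<noteq> g x (Suc s)} \<le> n"
    using assms by (auto simp: n_ce_def)
  define f :: "nat \<Rightarrow> nat \<Rightarrow> rat" where "f = (\<lambda>x s. of_nat (g x s))"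
  have "computable2_rat f"
    unfolding f_def using comp g01 by (rule computable2_rat_of_nat)
  moreover have "f x s \<in> {0..1}" for x s
    using g01[of x s] by (auto simp: f_def)
  moreover have "(\<lambda>s. real_of_rat (f x s)) \<longlonglongrightarrow> indicator A x" for x
  proof (rule tendsto_eventually)
    \<comment> \<open>Convergence in the discrete space \<open>nat\<close> is eventual equality,
      which survives the embedding into the reals.\<close>
    have "eventually (\<lambda>s. g x s = indicator A x) sequentially"
      using lim[of x] by (simp add: nhds_discrete filterlim_principal)
    then show "eventually (\<lambda>s. real_of_rat (f x s) = indicator A x) sequentially"
      by eventually_elim (simp add: f_def indicator_def)
  qed
  moreover have "f x 0 = 0" for x
    by (simp add: f_def g0)
  moreover have "finite {s. mind_change f x (Suc s) \<noteq> mind_change f x s} \<and>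
      card {s. mind_change f x (Suc s) \<noteq> mind_change f x s} \<le> n - 1" for x
  proof -
    have "(f x s \<noteq> f x (Suc s)) = (g x s \<noteq> g x (Suc s))" for s
      by (simp add: f_def)
    then show ?thesis
      using finite_card_mind_changes[of f x] fin[of x] card[of x]
      by (simp add: f_def g0 del: mind_change.simps) linarith
  qed
  ultimately show ?thesis
    unfolding fuzzy_n_ce_def using fuzzy_set_indicator
    by (auto simp del: mind_change.simps intro!: exI[of _ f])
qed

lemma fuzzy_n_ce_imp_n_ce:
  assumes "n \<ge> 1" and "fuzzy_n_ce n (indicator A)"
  shows "n_ce n A"
proof -
  obtain f :: "nat \<Rightarrow> nat \<Rightarrow> rat" where comp: "computable2_rat f"
    and f01: "\<And>x s. f x s \<in> {0..1}"
    and lim: "\<And>x. (\<lambda>s. real_of_rat (f x s)) \<longlonglongrightarrow> indicator A x"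
    and f0: "\<And>x. f x 0 = 0"
    and fin: "\<And>x. finite {s. mind_change f x (Suc s) \<noteq> mind_change f x s}"
    and card: "\<And>x. card {s. mind_change f x (Suc s) \<noteq> mind_change f x s} \<le> n - 1"
    using assms(2) unfolding fuzzy_n_ce_def Suc_eq_plus1 by blast
  define g :: "nat \<Rightarrow> nat \<Rightarrow> nat" where "g = (\<lambda>x s. if 1/2 < f x s then 1 else 0)"
  have "computable2 g"
    unfolding g_def using comp f01 by (intro computable2_gt_half) auto
  moreover have "g x s \<in> {0, 1}" for x s
    by (simp add: g_def)
  moreover have "g x \<longlonglongrightarrow> indicator A x" for x
  proof -
    have "1/2 < f x s \<longleftrightarrow> 1/2 < real_of_rat (f x s)" for s
      using of_rat_less[of "1/2" "f x s", where ?'a = real] by (simp add: of_rat_divide)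
    then have g_eq: "g x s = (if 1/2 < real_of_rat (f x s) then 1 else 0)" for s
      by (simp only: g_def)
    \<comment> \<open>The threshold lies strictly between the possible limits 0 and 1, so the
      rounded values stabilise even if \<open>f\<close> never reaches its limit.\<close>
    have "eventually (\<lambda>s. g x s = indicator A x) sequentially"
    proof (cases "x \<in> A")
      case True
      then have "eventually (\<lambda>s. 1/2 < real_of_rat (f x s)) sequentially"
        using order_tendstoD(1)[OF lim[of x], of "1/2"] by simp
      then show ?thesis by eventually_elim (simp add: g_eq True)
    next
      case False
      then have "eventually (\<lambda>s. real_of_rat (f x s) < 1/2) sequentially"
        using order_tendstoD(2)[OF lim[of x], of "1/2"] by simp
      then show ?thesis by eventually_elim (simp add: g_eq False)
    qed
    then show ?thesis by (rule tendsto_eventually)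
  qed
  moreover have "g x 0 = 0" for x
    by (simp add: g_def f0)
  moreover have "finite {s. g x s \<noteq> g x (s + 1)} \<and> card {s. g x s \<noteq> g x (s + 1)} \<le> n" for x
  proof -
    have "{s. g x s \<noteq> g x (s + 1)} = {s. (1/2 < f x s) \<noteq> (1/2 < f x (Suc s))}"
      by (auto simp: g_def)
    \<comment> \<open>There are at most \<open>Suc (n - 1)\<close> crossings, which is
      \<open>n\<close> because \<open>n\<close> \<ge> 1.\<close>
    then show ?thesis
      using finite_card_threshold_changes[of f x "1/2"] f0[of x] fin[of x] card[of x] assms(1)
      by (simp del: mind_change.simps) linarith
  qed
  ultimately show ?thesis
    unfolding n_ce_def by (auto intro!: exI[of _ g])
qed

theorem proposition4:
  fixes A :: "nat set" and n :: nat
  assumes "n \<ge> 1"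
  shows "(n_ce n A \<longleftrightarrow> fuzzy_n_ce n (indicator A)) \<and>
         (co_n_ce n A \<longleftrightarrow> fuzzy_co_n_ce n (indicator A))"
  \<comment> \<open>After unfolding, the second equivalence is the first one for
    \<open>- A\<close>.\<close>
  unfolding co_n_ce_def fuzzy_co_n_ce_def fuzzy_complement_indicator
  using n_ce_imp_fuzzy_n_ce fuzzy_n_ce_imp_n_ce[OF assms] fuzzy_set_indicator by blast

end
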